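(* Let $f,g_1,\ldots,g_m\in\mathbb{R}[\mathbf{x}]$ be real polynomials in $\mathbf{x}=(x_1,\ldots,x_n)$, and let $\mathbf{K}=\{\mathbf{x}\in\mathbb{R}^n : g_j(\mathbf{x})\ge 0,\ j=1,\ldots,m\}$. Assume that $\mathbf{K}$ is compact, that $0\le g_j\le 1$ on $\mathbf{K}$ for all $j=1,\ldots,m$, and that the family of polynomials $\{g_j,\,1-g_j : j=1,\ldots,m\}$ generates the algebra $\mathbb{R}[\mathbf{x}]$. Let $f^*=\min\{f(\mathbf{x}) : \mathbf{x}\in\mathbf{K}\}$. For $d\in\mathbb{N}$ let $$\rho_d=\sup_{\lambda\ge 0} G_d(\lambda),\qquad G_d(\lambda)=\inf_{\mathbf{x}\in\mathbb{R}^n}\Big\{f(\mathbf{x})-\sum_{(\alpha,\beta)\in\mathbb{N}^{2m}_d}\lambda_{\alpha\beta}\Big(\prod_{j=1}^m g_j(\mathbf{x})^{\alpha_j}\Big)\Big(\prod_{j=1}^m(1-g_j(\mathbf{x}))^{\beta_j}\Big)\Big\}.$$ Then the sequence $(\rho_d)_{d\in\mathbb{N}}$ is monotone nondecreasing and $\rho_d\to f^*$ as $d\to\infty$.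
   Context: $\mathbb{N}^{2m}_d=\{(\alpha,\beta)\in\mathbb{N}^m\times\mathbb{N}^m : \sum_{j=1}^m(\alpha_j+\beta_j)\le d\}$, where $\mathbb{N}$ includes $0$. The variable $\lambda=(\lambda_{\alpha\beta})_{(\alpha,\beta)\in\mathbb{N}^{2m}_d}$ is a real vector, and $\lambda\ge0$ means that all its entries are nonnegative. $G_d(\lambda)$ and $\rho_d$ are understood in the extended reals (they may equal $-\infty$). The set $\mathbf{K}$ is nonempty, so that the minimum $f^*$ exists. *)

theory Defs
  imports "HOL-Analysis.Analysis" "HOL-Library.Poly_Mapping"
begin

text \<open>
  Formal real polynomials in finitely many variables indexed by \<open>'n\<close>: a monomial is its exponent
  vector, a polynomial maps finitely many monomials to nonzero coefficients, and multiplication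
  (convolution) is the library's ring structure on \<open>poly_mapping\<close>.
\<close>

type_synonym 'n rpoly = "('n \<Rightarrow>\<^sub>0 nat) \<Rightarrow>\<^sub>0 real"

definition rpoly_const :: "real \<Rightarrow> 'n rpoly" where
  "rpoly_const c = Poly_Mapping.single 0 c"

definition rpoly_eval :: "'n::finite rpoly \<Rightarrow> real ^ 'n \<Rightarrow> real" where
  "rpoly_eval p x =
     (\<Sum>t\<in>Poly_Mapping.keys p. Poly_Mapping.lookup p t * (\<Prod>i\<in>UNIV. (x $ i) ^ Poly_Mapping.lookup t i))"

text \<open>Unital \<open>\<real>\<close>-subalgebras; scalar multiplication is multiplication by a constant polynomial.\<close>

definition rpoly_subalgebra :: "'n rpoly set \<Rightarrow> bool" where
  "rpoly_subalgebra A \<longleftrightarrow>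
     (\<forall>c. rpoly_const c \<in> A) \<and> (\<forall>p\<in>A. \<forall>q\<in>A. p + q \<in> A) \<and> (\<forall>p\<in>A. \<forall>q\<in>A. p * q \<in> A)"

definition generates_rpoly_algebra :: "'n rpoly set \<Rightarrow> bool" where
  "generates_rpoly_algebra S \<longleftrightarrow> rpoly_subalgebra hull S = UNIV"

definition semialg_set :: "nat \<Rightarrow> (nat \<Rightarrow> 'n::finite rpoly) \<Rightarrow> (real ^ 'n) set" where
  "semialg_set m g = {x. \<forall>j\<in>{1..m}. rpoly_eval (g j) x \<ge> 0}"

text \<open>
  A multi-index in \<open>\<nat>\<^sup>m\<close> is a function on \<open>nat\<close> vanishing outside \<open>{1..m}\<close>, so that distinct
  functions are distinct multi-indices and the set below is finite.
\<close>

definition index_pairs :: "nat \<Rightarrow> nat \<Rightarrow> ((nat \<Rightarrow> nat) \<times> (nat \<Rightarrow> nat)) set" where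
  "index_pairs m d =
     {(\<alpha>, \<beta>). (\<forall>j. j \<notin> {1..m} \<longrightarrow> \<alpha> j = 0 \<and> \<beta> j = 0) \<and> (\<Sum>j=1..m. \<alpha> j + \<beta> j) \<le> d}"

lemma finite_index_pairs: "finite (index_pairs m d)"
proof -
  let ?F = "{h. \<forall>j. (j \<in> {1..m} \<longrightarrow> h j \<in> {..d}) \<and> (j \<notin> {1..m} \<longrightarrow> h j = (0::nat))}"
  have "\<alpha> j \<le> d \<and> \<beta> j \<le> d" if "(\<alpha>, \<beta>) \<in> index_pairs m d" "j \<in> {1..m}" for \<alpha> \<beta> j
    using that member_le_sum[of j "{1..m}" "\<lambda>j. \<alpha> j + \<beta> j"] by (simp add: index_pairs_def)
  moreover have "\<alpha> j = 0 \<and> \<beta> j = 0" if "(\<alpha>, \<beta>) \<in> index_pairs m d" "j \<notin> {1..m}" for \<alpha> \<beta> j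
    using that unfolding index_pairs_def by blast
  ultimately have sub: "index_pairs m d \<subseteq> ?F \<times> ?F"
    unfolding mem_Collect_eq atMost_iff by (intro subrelI SigmaI CollectI) blast+
  have fin: "finite ?F"
    by (rule finite_set_of_finite_funs) simp_all
  show ?thesis
    by (rule finite_subset[OF sub finite_cartesian_product[OF fin fin]])
qed

text \<open>Only the values of the weight vector \<open>l\<close> on \<open>index_pairs m d\<close> matter in the next two definitions.\<close>

definition G_relax ::
  "'n::finite rpoly \<Rightarrow> nat \<Rightarrow> (nat \<Rightarrow> 'n rpoly) \<Rightarrow> nat \<Rightarrow> ((nat \<Rightarrow> nat) \<times> (nat \<Rightarrow> nat) \<Rightarrow> real) \<Rightarrow> ereal"
  where
  "G_relax f m g d l =
     (INF x. ereal (rpoly_eval f x -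
        (\<Sum>(\<alpha>, \<beta>)\<in>index_pairs m d.
           l (\<alpha>, \<beta>) * (\<Prod>j=1..m. rpoly_eval (g j) x ^ \<alpha> j)
                   * (\<Prod>j=1..m. (1 - rpoly_eval (g j) x) ^ \<beta> j))))"

definition rho :: "'n::finite rpoly \<Rightarrow> nat \<Rightarrow> (nat \<Rightarrow> 'n rpoly) \<Rightarrow> nat \<Rightarrow> ereal" where
  "rho f m g d = (SUP l\<in>{l. \<forall>i\<in>index_pairs m d. l i \<ge> 0}. G_relax f m g d l)"

text \<open>\<open>LEAST\<close> is the attained minimum whenever one exists (\<open>Min\<close> is for finite sets only).\<close>

definition min_on :: "('a \<Rightarrow> real) \<Rightarrow> 'a set \<Rightarrow> real" where
  "min_on h K = (LEAST v. v \<in> h ` K)"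

lemma min_on_compact:
  fixes h :: "'a::topological_space \<Rightarrow> real"
  assumes "compact K" "K \<noteq> {}" "continuous_on K h"
  shows "min_on h K \<in> h ` K" and "x \<in> K \<Longrightarrow> min_on h K \<le> h x"
proof -
  obtain a where a: "a \<in> K" "\<And>y. y \<in> K \<Longrightarrow> h a \<le> h y"
    using continuous_attains_inf[OF assms] by blast
  then have "min_on h K = h a"
    unfolding min_on_def by (intro Least_equality) auto
  with a show "min_on h K \<in> h ` K" "x \<in> K \<Longrightarrow> min_on h K \<le> h x"
    by auto
qed

end

theory Submission
  imports Defs
begin

text \<open>
  The upper bound \<open>\<rho>\<^sub>d \<le> f\<^sup>*\<close> and monotonicity are immediate: at a minimizer on \<open>K\<close> every product
  \<open>g\<^sup>\<alpha> (1 - g)\<^sup>\<beta>\<close> is nonnegative, and weights of degree \<open>d\<close> extend by zero to higher degree. The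
  content is the lower bound, which follows once every polynomial \<open>f\<close> positive on \<open>K\<close> is a
  nonnegative combination of these products (\<open>positive_polynomial_representation\<close>): for \<open>\<epsilon> > 0\<close>
  this applies to \<open>f - f\<^sup>* + \<epsilon>\<close>, and the weights obtained make the function under the infimum
  constantly \<open>f\<^sup>* - \<epsilon>\<close>.

  The representation is obtained by passing to the cube. Since the \<open>g\<^sub>j\<close> generate the polynomial
  algebra, there are polynomials \<open>F\<close> and \<open>h\<^sub>i\<close> in new variables \<open>y\<^sub>1, \<dots>, y\<^sub>m\<close> with \<open>f = F(g)\<close> and
  \<open>x\<^sub>i = h\<^sub>i(g(x))\<close>. Thus \<open>x \<mapsto> g(x)\<close> embeds \<open>\<real>\<^sup>n\<close> in \<open>\<real>\<^sup>m\<close>, and its image is the zero set of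
  \<open>q(y) = \<Sum>\<^sub>j (y\<^sub>j - g\<^sub>j(h(y)))\<^sup>2\<close>. A point of the cube \<open>[0,1]\<^sup>m\<close> with \<open>q(y) = 0\<close> is \<open>g(x)\<close> for some
  \<open>x \<in> K\<close>, so \<open>F\<close> is positive there; by compactness of the cube \<open>F + C q\<close> is positive on all of it
  when \<open>C\<close> is large. Bernstein's theorem (\<open>bernstein_positive_on_cube\<close>) writes \<open>F + C q\<close> as a
  nonnegative combination of the products \<open>y\<^sup>\<alpha> (1 - y)\<^sup>\<beta>\<close>. Substituting \<open>y = g(x)\<close> makes \<open>q\<close> vanish
  and leaves the desired identity for \<open>f\<close>.

  Bernstein's theorem holds because the coefficients of a polynomial in the Bernstein basis of
  degree \<open>N\<close> in each variable differ by \<open>O(1/N)\<close> from its values at the grid points \<open>k/N\<close>.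
\<close>

section \<open>Polynomial functions of the coordinates in a finite index set\<close>

text \<open>
  Polynomials in the auxiliary variables \<open>y\<^sub>j\<close> enter only through their values, so they are taken as
  functions. Generation by scaled monomials and sums gives an induction in which linear statements
  need checking on monomials only.
\<close>

inductive polyfun :: "'i set \<Rightarrow> (('i \<Rightarrow> real) \<Rightarrow> real) \<Rightarrow> bool" for J where
  monomial: "polyfun J (\<lambda>y. c * (\<Prod>j\<in>J. y j ^ \<gamma> j))"
| add: "polyfun J p \<Longrightarrow> polyfun J q \<Longrightarrow> polyfun J (\<lambda>y. p y + q y)"

lemma polyfun_const: "polyfun J (\<lambda>y. c)"
  using polyfun.monomial[of J c "\<lambda>_. 0"] by simp

lemma polyfun_coordinate:
  assumes "finite J" "i \<in> J"
  shows "polyfun J (\<lambda>y. y i)"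
proof -
  have "(\<Prod>j\<in>J. y j ^ (if j = i then 1 else 0)) = y i" for y :: "'a \<Rightarrow> real"
    using assms by (simp add: if_distrib[of "\<lambda>e. y _ ^ e"] prod.delta cong: if_cong)
  then show ?thesis
    using polyfun.monomial[of J 1 "\<lambda>j. if j = i then 1 else 0"] by simp
qed

lemma polyfun_mult:
  assumes "polyfun J p" "polyfun J q"
  shows "polyfun J (\<lambda>y. p y * q y)"
  using assms(1)
proof induction
  case (monomial c \<gamma>)
  show ?case
    using assms(2)
  proof induction
    case (monomial c' \<gamma>')
    show ?case
      using polyfun.monomial[of J "c * c'" "\<lambda>j. \<gamma> j + \<gamma>' j"]
      by (simp add: power_add prod.distrib mult_ac)
  next
    case (add p q)
    then show ?case
      using polyfun.add[OF add.IH] by (simp add: distrib_left)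
  qed
next
  case (add p q)
  then show ?case
    using polyfun.add[OF add.IH] by (simp add: distrib_right)
qed

lemma polyfun_diff:
  assumes "polyfun J p" "polyfun J q"
  shows "polyfun J (\<lambda>y. p y - q y)"
  using polyfun.add[OF assms(1) polyfun_mult[OF polyfun_const[of J "-1"] assms(2)]] by simp

lemma polyfun_power: "polyfun J p \<Longrightarrow> polyfun J (\<lambda>y. p y ^ k)"
  by (induction k) (simp_all add: polyfun_const polyfun_mult)

lemma polyfun_sum: "(\<And>i. i \<in> A \<Longrightarrow> polyfun J (p i)) \<Longrightarrow> polyfun J (\<lambda>y. \<Sum>i\<in>A. p i y)"
  by (induction A rule: infinite_finite_induct) (simp_all add: polyfun_const polyfun.add)

lemma polyfun_prod: "(\<And>i. i \<in> A \<Longrightarrow> polyfun J (p i)) \<Longrightarrow> polyfun J (\<lambda>y. \<Prod>i\<in>A. p i y)"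
  by (induction A rule: infinite_finite_induct) (simp_all add: polyfun_const polyfun_mult)

text \<open>
  Coordinates outside \<open>J\<close> are dummies; this is what allows them to be fixed when compactness of the
  cube is needed.
\<close>

lemma polyfun_cong:
  assumes "polyfun J p" "\<And>j. j \<in> J \<Longrightarrow> y j = z j"
  shows "p y = p z"
  using assms(1) by induction (auto simp: assms(2))

lemma continuous_on_polyfun:
  assumes "polyfun J p"
  shows "continuous_on A p"
proof -
  have coord: "continuous_on A (\<lambda>y. y j)" for j :: 'a
    by (rule continuous_on_subset[OF continuous_on_product_coordinates]) simp
  show ?thesis
    using assms
  proof induction
    case (monomial c \<gamma>)
    show ?case
      by (intro continuous_on_mult continuous_on_const continuous_on_prod continuous_on_power coord)
  next
    case (add p q)
    then show ?case
      by (intro continuous_on_add)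
  qed
qed

section \<open>Bernstein's theorem on the cube\<close>

text \<open>
  Since \<open>(N choose k) (k choose c) = (N choose c) (N - c choose k - c)\<close>, the sum is
  \<open>u\<^sup>c (u + (1 - u))\<^bsup>N - c\<^esup>\<close> expanded by the binomial theorem.
\<close>

lemma bernstein_expansion_power:
  fixes u :: real
  assumes "c \<le> N"
  shows "u ^ c = (\<Sum>k\<le>N. real (k choose c) / real (N choose c) * (real (N choose k) * u ^ k * (1 - u) ^ (N - k)))"
proof -
  have "(\<Sum>k\<le>N. real (k choose c) / real (N choose c) * (real (N choose k) * u ^ k * (1 - u) ^ (N - k)))
      = (\<Sum>k\<in>{c..N}. real (k choose c) / real (N choose c) * (real (N choose k) * u ^ k * (1 - u) ^ (N - k)))"
    by (rule sum.mono_neutral_right) (auto simp: binomial_eq_0 not_le)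
  also have "\<dots> = (\<Sum>k\<in>{c..N}. real ((N - c) choose (k - c)) * u ^ k * (1 - u) ^ (N - k))"
  proof (rule sum.cong)
    fix k assume k: "k \<in> {c..N}"
    then have "(N choose k) * (k choose c) = (N choose c) * ((N - c) choose (k - c))"
      by (intro choose_mult) auto
    then have "real (N choose k) * real (k choose c) = real (N choose c) * real ((N - c) choose (k - c))"
      by (metis of_nat_mult)
    moreover have "real (N choose c) \<noteq> 0"
      using assms by (simp add: binomial_eq_0_iff)
    ultimately have "real (k choose c) / real (N choose c) * real (N choose k) = real ((N - c) choose (k - c))"
      by (simp add: field_simps)
    then show "real (k choose c) / real (N choose c) * (real (N choose k) * u ^ k * (1 - u) ^ (N - k))
        = real ((N - c) choose (k - c)) * u ^ k * (1 - u) ^ (N - k)"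
      by (metis mult.assoc)
  qed simp
  also have "\<dots> = (\<Sum>k\<le>N - c. real ((N - c) choose k) * u ^ (k + c) * (1 - u) ^ (N - c - k))"
    by (rule sum.reindex_bij_witness[where i = "\<lambda>k. k + c" and j = "\<lambda>k. k - c"])
      (use assms in auto)
  also have "\<dots> = u ^ c * (u + (1 - u)) ^ (N - c)"
    unfolding binomial_ring by (simp add: sum_distrib_left power_add mult_ac)
  finally show ?thesis by simp
qed

lemma binomial_ratio_le_1:
  assumes "k \<le> N" "c \<le> N"
  shows "real (k choose c) / real (N choose c) \<in> {0..1}"
  using assms binomial_right_mono[of k N c] by (simp add: divide_le_eq_1)

text \<open>
  The ratio is the product of the factors \<open>(k - i) / (N - i)\<close> for \<open>i < c\<close>, each within \<open>i / N\<close> of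
  \<open>k / N\<close>. As all factors lie in \<open>[0,1]\<close>, the errors add up to at most
  \<open>0 + 1 + \<dots> + (c - 1) \<le> c\<^sup>2\<close> over \<open>N\<close>.
\<close>

lemma binomial_ratio_approx:
  assumes "k \<le> N" "c \<le> N"
  shows "\<bar>real (k choose c) / real (N choose c) - (real k / real N) ^ c\<bar> \<le> real (c * c) / real N"
  using assms(2)
proof (induction c)
  case 0
  then show ?case by simp
next
  case (Suc c)
  define r where "r = real (k choose c) / real (N choose c)"
  define s where "s = real (k - c) / real (N - c)"
  define t where "t = real k / real N"
  have step: "real (Suc c) * real (n choose Suc c) = real (n - c) * real (n choose c)" for n
    using binomial_absorption[of c n] binomial_absorb_comp[of n c] by (metis of_nat_mult)
  have "real (n choose Suc c) = real (n - c) * real (n choose c) / real (Suc c)" for n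
    using step[of n] by (simp add: field_simps del: of_nat_Suc binomial_Suc_Suc)
  then have ratio: "real (k choose Suc c) / real (N choose Suc c) = s * r"
    by (simp add: r_def s_def del: of_nat_Suc)
  have r01: "0 \<le> r" "r \<le> 1"
    using binomial_ratio_le_1[of k N c] assms(1) Suc.prems by (auto simp: r_def)
  have t01: "0 \<le> t" "t \<le> 1"
    using assms(1) Suc.prems by (auto simp: t_def divide_le_eq_1)
  have pos: "real N > 0" "real (N - c) > 0" "real (N - c) = real N - real c"
    using Suc.prems by auto
  have st: "\<bar>s - t\<bar> \<le> real c / real N"
    \<comment> \<open>For \<open>k < c\<close> truncated subtraction gives \<open>s = 0\<close>, in accordance with the vanishing binomial.\<close>
  proof (cases "c \<le> k")
    case True
    have "t - s = (real c / real N) * (real (N - k) / real (N - c))"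
      using pos True assms(1) unfolding s_def t_def by (simp add: of_nat_diff field_simps)
    moreover have "0 \<le> real (N - k) / real (N - c)" "real (N - k) / real (N - c) \<le> 1"
      using pos True by (auto simp: divide_le_eq_1 intro: diff_le_mono2)
    ultimately have "0 \<le> t - s" "t - s \<le> real c / real N"
      by (simp_all only: mult_nonneg_nonneg divide_nonneg_nonneg of_nat_0_le_iff mult_left_le)
    then show ?thesis by linarith
  next
    case False
    then show ?thesis
      using pos by (simp add: s_def t_def divide_right_mono)
  qed
  have "s * r - t ^ Suc c = r * (s - t) + t * (r - t ^ c)"
    by (simp add: algebra_simps)
  also have "\<bar>\<dots>\<bar> \<le> r * \<bar>s - t\<bar> + t * \<bar>r - t ^ c\<bar>"
    using r01 t01 by (metis abs_triangle_ineq abs_mult abs_of_nonneg)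
  also have "\<dots> \<le> \<bar>s - t\<bar> + \<bar>r - t ^ c\<bar>"
    using r01 t01 by (intro add_mono mult_left_le_one_le) auto
  also have "\<dots> \<le> real c / real N + real (c * c) / real N"
    using st Suc by (intro add_mono) (auto simp: r_def t_def)
  also have "\<dots> \<le> real (Suc c * Suc c) / real N"
    using pos by (simp flip: add_divide_distrib add: divide_right_mono)
  finally show ?case
    unfolding ratio t_def .
qed

text \<open>
  Both claims are stable under sums, so it suffices to treat a monomial: its Bernstein coefficients
  are products over \<open>j\<close> of the one-variable coefficients, and products of numbers in \<open>[-1,1]\<close> differ
  by at most the sum of the differences of their factors.
\<close>

lemma bernstein_form_approx:
  assumes "finite J" "polyfun J p"
  shows "\<exists>M N0. \<forall>N\<ge>N0. \<exists>b.
    (\<forall>y. p y = (\<Sum>k\<in>J \<rightarrow>\<^sub>E {..N}. b k * (\<Prod>j\<in>J. real (N choose k j) * y j ^ k j * (1 - y j) ^ (N - k j))))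
    \<and> (\<forall>k\<in>J \<rightarrow>\<^sub>E {..N}. \<bar>b k - p (\<lambda>j. real (k j) / real N)\<bar> \<le> M / real N)"
  using assms(2)
proof induction
  case (monomial c \<gamma>)
  define M where "M = \<bar>c\<bar> * (\<Sum>j\<in>J. real (\<gamma> j * \<gamma> j))"
  define N0 where "N0 = (\<Sum>j\<in>J. \<gamma> j)"
  show ?case
  proof (intro exI[of _ M] exI[of _ N0] allI impI)
    fix N assume N: "N0 \<le> N"
    have le: "\<gamma> j \<le> N" if "j \<in> J" for j
      using member_le_sum[of j J \<gamma>] assms(1) that N by (simp add: N0_def)
    define r where "r k j = real (k j choose \<gamma> j) / real (N choose \<gamma> j)" for k j
    have "c * (\<Prod>j\<in>J. y j ^ \<gamma> j)
        = (\<Sum>k\<in>J \<rightarrow>\<^sub>E {..N}. (c * (\<Prod>j\<in>J. r k j)) *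
            (\<Prod>j\<in>J. real (N choose k j) * y j ^ k j * (1 - y j) ^ (N - k j)))" for y
    proof -
      have "(\<Prod>j\<in>J. y j ^ \<gamma> j) = (\<Prod>j\<in>J. \<Sum>k\<le>N. real (k choose \<gamma> j) / real (N choose \<gamma> j)
          * (real (N choose k) * y j ^ k * (1 - y j) ^ (N - k)))"
        using le by (intro prod.cong bernstein_expansion_power) auto
      also have "\<dots> = (\<Sum>k\<in>J \<rightarrow>\<^sub>E {..N}. \<Prod>j\<in>J. r k j
          * (real (N choose k j) * y j ^ k j * (1 - y j) ^ (N - k j)))"
        unfolding r_def using assms(1) by (intro prod_sum_PiE) auto
      finally show ?thesis
        by (simp add: sum_distrib_left prod.distrib mult.assoc)
    qed
    moreover have "\<bar>c * (\<Prod>j\<in>J. r k j) - c * (\<Prod>j\<in>J. (real (k j) / real N) ^ \<gamma> j)\<bar> \<le> M / real N"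
      if k: "k \<in> J \<rightarrow>\<^sub>E {..N}" for k
    proof -
      have kN: "k j \<le> N" if "j \<in> J" for j
        using PiE_mem[OF k that] by simp
      have "\<bar>(\<Prod>j\<in>J. r k j) - (\<Prod>j\<in>J. (real (k j) / real N) ^ \<gamma> j)\<bar>
          \<le> (\<Sum>j\<in>J. \<bar>r k j - (real (k j) / real N) ^ \<gamma> j\<bar>)"
        unfolding real_norm_def[symmetric]
      proof (rule norm_prod_diff)
        fix j assume j: "j \<in> J"
        show "norm (r k j) \<le> 1"
          using binomial_ratio_le_1[OF kN[OF j] le[OF j]] by (simp add: r_def)
        have "real (k j) / real N \<le> 1"
          using kN[OF j] by (auto simp: divide_le_eq_1)
        then show "norm ((real (k j) / real N) ^ \<gamma> j) \<le> 1"
          unfolding real_norm_def power_abs abs_of_nonneg[OF divide_nonneg_nonneg[OF of_nat_0_le_iff of_nat_0_le_iff]]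
          by (intro power_le_one) auto
      qed
      also have "\<dots> \<le> (\<Sum>j\<in>J. real (\<gamma> j * \<gamma> j) / real N)"
        unfolding r_def using kN le by (intro sum_mono binomial_ratio_approx) auto
      finally show ?thesis
        unfolding M_def right_diff_distrib[symmetric] abs_mult sum_divide_distrib[symmetric]
          times_divide_eq_right[symmetric]
        by (rule mult_left_mono) simp
    qed
    ultimately show "\<exists>b. (\<forall>y. c * (\<Prod>j\<in>J. y j ^ \<gamma> j)
          = (\<Sum>k\<in>J \<rightarrow>\<^sub>E {..N}. b k * (\<Prod>j\<in>J. real (N choose k j) * y j ^ k j * (1 - y j) ^ (N - k j))))
        \<and> (\<forall>k\<in>J \<rightarrow>\<^sub>E {..N}. \<bar>b k - c * (\<Prod>j\<in>J. (real (k j) / real N) ^ \<gamma> j)\<bar> \<le> M / real N)"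
      by (intro exI[of _ "\<lambda>k. c * (\<Prod>j\<in>J. r k j)"]) blast
  qed
next
  case (add p q)
  let ?B = "\<lambda>N k y. \<Prod>j\<in>J. real (N choose k j) * y j ^ k j * (1 - y j) ^ (N - k j)"
  obtain M1 N1 where 1: "\<And>N. N \<ge> N1 \<Longrightarrow> \<exists>b. (\<forall>y. p y = (\<Sum>k\<in>J \<rightarrow>\<^sub>E {..N}. b k * ?B N k y))
      \<and> (\<forall>k\<in>J \<rightarrow>\<^sub>E {..N}. \<bar>b k - p (\<lambda>j. real (k j) / real N)\<bar> \<le> M1 / real N)"
    using add.IH(1) by blast
  obtain M2 N2 where 2: "\<And>N. N \<ge> N2 \<Longrightarrow> \<exists>b. (\<forall>y. q y = (\<Sum>k\<in>J \<rightarrow>\<^sub>E {..N}. b k * ?B N k y))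
      \<and> (\<forall>k\<in>J \<rightarrow>\<^sub>E {..N}. \<bar>b k - q (\<lambda>j. real (k j) / real N)\<bar> \<le> M2 / real N)"
    using add.IH(2) by blast
  show ?case
  proof (intro exI[of _ "M1 + M2"] exI[of _ "max N1 N2"] allI impI)
    fix N assume N: "max N1 N2 \<le> N"
    obtain b1 where b1: "\<And>y. p y = (\<Sum>k\<in>J \<rightarrow>\<^sub>E {..N}. b1 k * ?B N k y)"
        "\<And>k. k\<in>J \<rightarrow>\<^sub>E {..N} \<Longrightarrow> \<bar>b1 k - p (\<lambda>j. real (k j) / real N)\<bar> \<le> M1 / real N"
      using 1[of N] N by auto
    obtain b2 where b2: "\<And>y. q y = (\<Sum>k\<in>J \<rightarrow>\<^sub>E {..N}. b2 k * ?B N k y)"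
        "\<And>k. k\<in>J \<rightarrow>\<^sub>E {..N} \<Longrightarrow> \<bar>b2 k - q (\<lambda>j. real (k j) / real N)\<bar> \<le> M2 / real N"
      using 2[of N] N by auto
    show "\<exists>b. (\<forall>y. p y + q y = (\<Sum>k\<in>J \<rightarrow>\<^sub>E {..N}. b k * ?B N k y))
      \<and> (\<forall>k\<in>J \<rightarrow>\<^sub>E {..N}. \<bar>b k - (p (\<lambda>j. real (k j) / real N) + q (\<lambda>j. real (k j) / real N))\<bar>
          \<le> (M1 + M2) / real N)"
    proof (intro exI[of _ "\<lambda>k. b1 k + b2 k"] conjI allI ballI)
      show "p y + q y = (\<Sum>k\<in>J \<rightarrow>\<^sub>E {..N}. (b1 k + b2 k) * ?B N k y)" for y
        unfolding distrib_right sum.distrib using b1(1)[of y] b2(1)[of y] by simp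
      show "\<bar>b1 k + b2 k - (p (\<lambda>j. real (k j) / real N) + q (\<lambda>j. real (k j) / real N))\<bar>
          \<le> (M1 + M2) / real N" if "k \<in> J \<rightarrow>\<^sub>E {..N}" for k
        using b1(2)[OF that] b2(2)[OF that] unfolding add_divide_distrib by linarith
    qed
  qed
qed

text \<open>
  Once \<open>M / N \<le> \<delta>\<close>, the coefficients cannot drop from the grid values, which are at least \<open>\<delta>\<close>,
  below zero. The binomial factors of the Bernstein basis are absorbed in the coefficients.
\<close>

theorem bernstein_positive_on_cube:
  assumes "finite J" "polyfun J p" "\<delta> > 0"
    and pos: "\<forall>y\<in>J \<rightarrow> {0..1}. p y \<ge> \<delta>"
  shows "\<exists>N b. (\<forall>k\<in>J \<rightarrow>\<^sub>E {..N}. b k \<ge> 0)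
    \<and> (\<forall>y. p y = (\<Sum>k\<in>J \<rightarrow>\<^sub>E {..N}. b k * ((\<Prod>j\<in>J. y j ^ k j) * (\<Prod>j\<in>J. (1 - y j) ^ (N - k j)))))"
proof -
  obtain M N0 where MN: "\<forall>N\<ge>N0. \<exists>b.
    (\<forall>y. p y = (\<Sum>k\<in>J \<rightarrow>\<^sub>E {..N}. b k * (\<Prod>j\<in>J. real (N choose k j) * y j ^ k j * (1 - y j) ^ (N - k j))))
    \<and> (\<forall>k\<in>J \<rightarrow>\<^sub>E {..N}. \<bar>b k - p (\<lambda>j. real (k j) / real N)\<bar> \<le> M / real N)"
    using bernstein_form_approx[OF assms(1,2)] by blast
  obtain N1 where N1: "M / \<delta> < real N1"
    using reals_Archimedean2 by blast
  define N where "N = max N0 (max N1 1)"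
  have "M / \<delta> \<le> real N" "real N > 0"
    using N1 by (auto simp: N_def)
  then have small: "M / real N \<le> \<delta>"
    using assms(3) by (simp add: field_simps)
  have "N0 \<le> N"
    by (simp add: N_def)
  from MN[rule_format, OF this] obtain b where
    b: "\<forall>y. p y = (\<Sum>k\<in>J \<rightarrow>\<^sub>E {..N}. b k * (\<Prod>j\<in>J. real (N choose k j) * y j ^ k j * (1 - y j) ^ (N - k j)))"
    and approx: "\<forall>k\<in>J \<rightarrow>\<^sub>E {..N}. \<bar>b k - p (\<lambda>j. real (k j) / real N)\<bar> \<le> M / real N"
    by (elim exE conjE)
  have b0: "b k \<ge> 0" if k: "k \<in> J \<rightarrow>\<^sub>E {..N}" for k
  proof -
    have "(\<lambda>j. real (k j) / real N) \<in> J \<rightarrow> {0..1}"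
      using PiE_mem[OF k] by (auto simp: divide_le_eq_1)
    then have "p (\<lambda>j. real (k j) / real N) \<ge> \<delta>"
      by (rule pos[rule_format])
    then show ?thesis
      using approx[rule_format, OF k] small by linarith
  qed
  show ?thesis
  proof (intro exI[of _ N] exI[of _ "\<lambda>k. b k * (\<Prod>j\<in>J. real (N choose k j))"] conjI ballI allI)
    show "0 \<le> b k * (\<Prod>j\<in>J. real (N choose k j))" if "k \<in> J \<rightarrow>\<^sub>E {..N}" for k
      using b0[OF that] by (simp add: prod_nonneg)
    show "p y = (\<Sum>k\<in>J \<rightarrow>\<^sub>E {..N}. b k * (\<Prod>j\<in>J. real (N choose k j))
        * ((\<Prod>j\<in>J. y j ^ k j) * (\<Prod>j\<in>J. (1 - y j) ^ (N - k j))))" for y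
      using b[rule_format, of y] by (simp add: prod.distrib mult.assoc)
  qed
qed

section \<open>Absorbing a zero set by a penalty\<close>

text \<open>
  On the compact set where \<open>F \<le> 0\<close> the penalty \<open>q\<close> is bounded away from zero, so a large multiple
  of it outweighs the minimum of \<open>F\<close>; elsewhere \<open>F\<close> is already positive.
\<close>

lemma compact_penalty:
  fixes F q :: "'a::topological_space \<Rightarrow> real"
  assumes "compact Q" "continuous_on Q F" "continuous_on Q q"
    and q_nonneg: "\<And>y. y \<in> Q \<Longrightarrow> q y \<ge> 0"
    and F_pos: "\<And>y. y \<in> Q \<Longrightarrow> q y = 0 \<Longrightarrow> F y > 0"
  obtains C \<delta> where "\<delta> > 0" "\<And>y. y \<in> Q \<Longrightarrow> F y + C * q y \<ge> \<delta>"
proof -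
  have "\<exists>C. \<forall>y\<in>Q. F y + C * q y > 0"
  proof (cases "{y \<in> Q. F y \<le> 0} = {}")
    case True
    then show ?thesis
      by (intro exI[of _ 0]) (auto simp: not_le)
  next
    case False
    let ?A = "{y \<in> Q. F y \<le> 0}"
    obtain T where T: "closed T" "T \<inter> Q = F -` {..0} \<inter> Q"
      using assms(2) closed_atMost[of "0::real"] unfolding continuous_on_closed_invariant by blast
    then have "?A = Q \<inter> T"
      by auto
    then have "compact ?A"
      using compact_Int_closed[OF assms(1) T(1)] by simp
    moreover have "continuous_on ?A q" "continuous_on ?A F"
      by (rule continuous_on_subset[OF assms(3)], blast) (rule continuous_on_subset[OF assms(2)], blast)
    ultimately have "\<exists>a\<in>?A. \<forall>y\<in>?A. q a \<le> q y" "\<exists>a\<in>?A. \<forall>y\<in>?A. F a \<le> F y"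
      using continuous_attains_inf[OF _ False] by blast+
    then obtain a a' where a: "a \<in> ?A" "\<And>y. y \<in> ?A \<Longrightarrow> q a \<le> q y"
      and a': "a' \<in> ?A" "\<And>y. y \<in> ?A \<Longrightarrow> F a' \<le> F y"
      by blast
    have qa: "q a > 0"
      using a(1) q_nonneg[of a] F_pos[of a] by fastforce
    \<comment> \<open>This choice makes \<open>F + C q\<close> at least \<open>1\<close> wherever \<open>F \<le> 0\<close>.\<close>
    define C where "C = (1 - F a') / q a"
    have C: "C \<ge> 0" "C * q a = 1 - F a'"
      using qa a'(1) by (auto simp: C_def)
    have "F y + C * q y > 0" if y: "y \<in> Q" for y
    proof (cases "F y \<le> 0")
      case True
      then have "C * q a \<le> C * q y" "F a' \<le> F y"
        using a(2) a'(2) y C(1) by (auto intro: mult_left_mono)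
      then show ?thesis
        using C(2) by linarith
    next
      case False
      then show ?thesis
        using C(1) q_nonneg[OF y] by (simp add: add_pos_nonneg)
    qed
    then show ?thesis by blast
  qed
  then obtain C where C: "\<And>y. y \<in> Q \<Longrightarrow> F y + C * q y > 0"
    by blast
  have "\<exists>\<delta>>0. \<forall>y\<in>Q. F y + C * q y \<ge> \<delta>"
  proof (cases "Q = {}")
    case False
    have "continuous_on Q (\<lambda>y. F y + C * q y)"
      using assms(2,3) by (intro continuous_intros)
    then obtain a where "a \<in> Q" "\<forall>y\<in>Q. F a + C * q a \<le> F y + C * q y"
      using continuous_attains_inf[OF assms(1) False] by blast
    then show ?thesis
      using C by blast
  qed (auto intro: exI[of _ 1])
  then show ?thesis
    using that by blast
qed

text \<open>
  The functions with values in \<open>[0,1]\<close> on \<open>J\<close> form a compact set only after the remaining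
  coordinates are pinned to \<open>0\<close>; polynomial functions on \<open>J\<close> do not see the difference.
\<close>

lemma polyfun_penalty_on_cube:
  assumes "polyfun J F" "polyfun J q"
    and "\<And>y. q y \<ge> 0"
    and "\<And>y. y \<in> J \<rightarrow> {0..1} \<Longrightarrow> q y = 0 \<Longrightarrow> F y > 0"
  obtains C \<delta> where "\<delta> > 0" "\<forall>y\<in>J \<rightarrow> {0..1}. F y + C * q y \<ge> \<delta>"
proof -
  define Q where "Q = (\<Pi>\<^sub>E j\<in>UNIV. if j \<in> J then {0..1::real} else {0})"
  have "compactin (product_topology (\<lambda>_. euclidean) UNIV) Q"
    unfolding Q_def by (subst compactin_PiE) simp
  then have Q: "compact Q"
    by (simp add: euclidean_product_topology)
  have "y \<in> J \<rightarrow> {0..1}" if "y \<in> Q" for y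
  proof
    show "y j \<in> {0..1}" if "j \<in> J" for j
      using PiE_mem[OF \<open>y \<in> Q\<close>[unfolded Q_def], of j] that by simp
  qed
  then have "F y > 0" if "y \<in> Q" "q y = 0" for y
    using assms(4) that by blast
  then obtain C \<delta> where C: "\<delta> > 0" "\<And>y. y \<in> Q \<Longrightarrow> F y + C * q y \<ge> \<delta>"
    using compact_penalty[OF Q continuous_on_polyfun[OF assms(1)]
        continuous_on_polyfun[OF assms(2)] assms(3)] by metis
  have poly: "polyfun J (\<lambda>y. F y + C * q y)"
    by (intro polyfun.add assms polyfun_mult polyfun_const)
  have "F y + C * q y \<ge> \<delta>" if y: "y \<in> J \<rightarrow> {0..1}" for y
  proof -
    have "(\<lambda>j. if j \<in> J then y j else 0) \<in> Q"
      using y by (auto simp: Q_def Pi_iff)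
    from C(2)[OF this] show ?thesis
      using polyfun_cong[OF poly, of y "\<lambda>j. if j \<in> J then y j else 0"] by simp
  qed
  then show ?thesis
    using that C(1) by blast
qed

section \<open>Evaluation of formal polynomials\<close>

lemma rpoly_eval_superset:
  assumes "finite A" "Poly_Mapping.keys p \<subseteq> A"
  shows "rpoly_eval p x = (\<Sum>t\<in>A. Poly_Mapping.lookup p t * (\<Prod>i\<in>UNIV. (x $ i) ^ Poly_Mapping.lookup t i))"
  unfolding rpoly_eval_def using assms
  by (intro sum.mono_neutral_left) (auto simp: in_keys_iff)

lemma rpoly_eval_add: "rpoly_eval (p + q) x = rpoly_eval p x + rpoly_eval q x"
proof -
  let ?A = "Poly_Mapping.keys p \<union> Poly_Mapping.keys q"
  have "Poly_Mapping.keys (p + q) \<subseteq> ?A"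
    by (rule Poly_Mapping.keys_add)
  then show ?thesis
    by (simp add: rpoly_eval_superset[of ?A] lookup_add distrib_right sum.distrib)
qed

lemma rpoly_eval_single:
  "rpoly_eval (Poly_Mapping.single t c) x = c * (\<Prod>i\<in>UNIV. (x $ i) ^ Poly_Mapping.lookup t i)"
  by (subst rpoly_eval_superset[of "{t}"]) auto

lemma rpoly_eval_const: "rpoly_eval (rpoly_const c) x = c"
  by (simp add: rpoly_const_def rpoly_eval_single)

lemma rpoly_eval_sum: "rpoly_eval (\<Sum>i\<in>A. p i) x = (\<Sum>i\<in>A. rpoly_eval (p i) x)"
  by (induction A rule: infinite_finite_induct) (simp_all add: rpoly_eval_add, simp_all add: rpoly_eval_def)

lemma rpoly_as_sum_of_terms:
  fixes p :: "'n rpoly"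
  shows "p = (\<Sum>t\<in>Poly_Mapping.keys p. Poly_Mapping.single t (Poly_Mapping.lookup p t))"
  by (rule poly_mapping_eqI) (auto simp: lookup_sum lookup_single when_def in_keys_iff)

lemma rpoly_eval_mult: "rpoly_eval (p * q) x = rpoly_eval p x * rpoly_eval q x"
proof -
  let ?T = "\<lambda>p t. Poly_Mapping.single t (Poly_Mapping.lookup p t)"
  have "p * q = (\<Sum>s\<in>Poly_Mapping.keys p. ?T p s) * (\<Sum>t\<in>Poly_Mapping.keys q. ?T q t)"
    using rpoly_as_sum_of_terms[of p] rpoly_as_sum_of_terms[of q] by simp
  also have "\<dots> = (\<Sum>s\<in>Poly_Mapping.keys p. \<Sum>t\<in>Poly_Mapping.keys q. ?T p s * ?T q t)"
    by (rule sum_product)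
  finally have "rpoly_eval (p * q) x
      = (\<Sum>s\<in>Poly_Mapping.keys p. \<Sum>t\<in>Poly_Mapping.keys q. rpoly_eval (?T p s) x * rpoly_eval (?T q t) x)"
    by (simp add: rpoly_eval_sum mult_single rpoly_eval_single lookup_add power_add prod.distrib mult_ac)
  then show ?thesis
    unfolding sum_product[symmetric] rpoly_eval_single by (simp add: rpoly_eval_def)
qed

lemma rpoly_eval_one_minus: "rpoly_eval (1 - p) x = 1 - rpoly_eval p x"
proof -
  have "rpoly_eval (1 - p) x + rpoly_eval p x = rpoly_eval (rpoly_const 1) x"
    by (simp flip: rpoly_eval_add add: rpoly_const_def)
  then show ?thesis
    by (simp add: rpoly_eval_const)
qed

lemma coordinate_is_rpoly_eval: "\<exists>p. \<forall>x. rpoly_eval p x = x $ i"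
proof (intro exI allI)
  show "rpoly_eval (Poly_Mapping.single (Poly_Mapping.single i 1) 1) x = x $ i" for x
    unfolding rpoly_eval_single
    by (simp add: lookup_single when_def if_distrib[of "\<lambda>e. _ ^ e"] prod.delta cong: if_cong)
qed

lemma polyfun_rpoly_eval_substitution:
  assumes "\<And>i. polyfun J (h i)"
  shows "polyfun J (\<lambda>y. rpoly_eval p (\<chi> i. h i y))"
  unfolding rpoly_eval_def
  by (simp, intro polyfun_sum polyfun_mult polyfun_const polyfun_prod polyfun_power assms)

text \<open>
  The polynomials whose values are polynomial functions of the values of the \<open>g\<^sub>j\<close> form a subalgebra
  containing all \<open>g\<^sub>j\<close> and \<open>1 - g\<^sub>j\<close>, hence are all polynomials.
\<close>

lemma rpoly_eval_as_polyfun_of_generators: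
  assumes "finite J" "generates_rpoly_algebra (\<Union>j\<in>J. {g j, 1 - g j})"
  shows "\<exists>P. polyfun J P \<and> (\<forall>x. rpoly_eval p x = P (\<lambda>j. rpoly_eval (g j) x))"
proof -
  let ?R = "\<lambda>p. \<exists>P. polyfun J P \<and> (\<forall>x. rpoly_eval p x = P (\<lambda>j. rpoly_eval (g j) x))"
  have "p \<in> rpoly_subalgebra hull (\<Union>j\<in>J. {g j, 1 - g j})"
    using assms(2) by (simp add: generates_rpoly_algebra_def)
  then show ?thesis
  proof (rule hull_induct)
    fix a assume "a \<in> (\<Union>j\<in>J. {g j, 1 - g j})"
    then obtain j where j: "j \<in> J" "a = g j \<or> a = 1 - g j"
      by auto
    have "polyfun J (\<lambda>y. y j)"
      using assms(1) j(1) by (rule polyfun_coordinate)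
    moreover from this have "polyfun J (\<lambda>y. 1 - y j)"
      by (intro polyfun_diff polyfun_const)
    ultimately show "?R a"
      using j(2) rpoly_eval_one_minus[of "g j"] by (elim disjE) blast+
  next
    show "rpoly_subalgebra {p. ?R p}"
      unfolding rpoly_subalgebra_def
    proof (intro conjI allI ballI; clarsimp)
      show "\<exists>P. polyfun J P \<and> (\<forall>x. rpoly_eval (rpoly_const c) x = P (\<lambda>j. rpoly_eval (g j) x))" for c
        by (intro exI[of _ "\<lambda>_. c"]) (simp add: polyfun_const rpoly_eval_const)
    next
      fix p q P Q
      assume P: "polyfun J P" "\<forall>x. rpoly_eval p x = P (\<lambda>j. rpoly_eval (g j) x)"
        and Q: "polyfun J Q" "\<forall>x. rpoly_eval q x = Q (\<lambda>j. rpoly_eval (g j) x)"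
      show "\<exists>P. polyfun J P \<and> (\<forall>x. rpoly_eval (p + q) x = P (\<lambda>j. rpoly_eval (g j) x))"
        using P Q polyfun.add[OF P(1) Q(1)]
        by (intro exI[of _ "\<lambda>y. P y + Q y"]) (simp add: rpoly_eval_add)
      show "\<exists>P. polyfun J P \<and> (\<forall>x. rpoly_eval (p * q) x = P (\<lambda>j. rpoly_eval (g j) x))"
        using P Q polyfun_mult[OF P(1) Q(1)]
        by (intro exI[of _ "\<lambda>y. P y * Q y"]) (simp add: rpoly_eval_mult)
    qed
  qed
qed

section \<open>The representation of positive polynomials\<close>

text \<open>
  The embedding of \<open>\<real>\<^sup>n\<close> by \<open>g\<close> turns positivity on the set where all \<open>g\<^sub>j\<close> lie in \<open>[0,1]\<close> into
  positivity on the intersection of the cube with a real zero set; adding a multiple of the squares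
  defining that set extends positivity to the cube without changing the values on the image of \<open>g\<close>.
\<close>

theorem positive_polynomial_representation:
  fixes f :: "'n::finite rpoly" and g :: "'i \<Rightarrow> 'n rpoly"
  assumes "finite J" "generates_rpoly_algebra (\<Union>j\<in>J. {g j, 1 - g j})"
    and f_pos: "\<forall>x. (\<lambda>j. rpoly_eval (g j) x) \<in> J \<rightarrow> {0..1} \<longrightarrow> rpoly_eval f x > 0"
  shows "\<exists>N b. (\<forall>k\<in>J \<rightarrow>\<^sub>E {..N}. b k \<ge> 0)
    \<and> (\<forall>x. rpoly_eval f x = (\<Sum>k\<in>J \<rightarrow>\<^sub>E {..N}.
      b k * ((\<Prod>j\<in>J. rpoly_eval (g j) x ^ k j) * (\<Prod>j\<in>J. (1 - rpoly_eval (g j) x) ^ (N - k j)))))"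
proof -
  note rep = rpoly_eval_as_polyfun_of_generators[OF assms(1,2)]
  obtain F where F: "polyfun J F" "\<And>x. rpoly_eval f x = F (\<lambda>j. rpoly_eval (g j) x)"
    using rep by blast
  have "\<forall>i::'n. \<exists>P. polyfun J P \<and> (\<forall>x. x $ i = P (\<lambda>j. rpoly_eval (g j) x))"
    using rep coordinate_is_rpoly_eval by metis
  then obtain h :: "'n \<Rightarrow> ('i \<Rightarrow> real) \<Rightarrow> real"
    where h: "\<And>i. polyfun J (h i)" "\<And>i x. x $ i = h i (\<lambda>j. rpoly_eval (g j) x)"
    by metis
  define H where "H y = (\<chi> i. h i y)" for y
  have H_g: "H (\<lambda>j. rpoly_eval (g j) x) = x" for x
    unfolding H_def by (simp add: vec_eq_iff flip: h(2))
  define q where "q y = (\<Sum>j\<in>J. (y j - rpoly_eval (g j) (H y))\<^sup>2)" for y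
  have q: "polyfun J q"
    unfolding q_def H_def
    by (intro polyfun_sum polyfun_power polyfun_diff polyfun_coordinate
        polyfun_rpoly_eval_substitution h(1) assms(1))
  have q_nonneg: "q y \<ge> 0" for y
    by (simp add: q_def sum_nonneg)
  have F_pos: "F y > 0" if y: "y \<in> J \<rightarrow> {0..1}" and q0: "q y = 0" for y
  proof -
    \<comment> \<open>A zero of \<open>q\<close> lies in the image of \<open>g\<close>, with preimage \<open>H y\<close>.\<close>
    have eq: "rpoly_eval (g j) (H y) = y j" if "j \<in> J" for j
      using q0 that assms(1) by (auto simp: q_def sum_nonneg_eq_0_iff)
    then have "rpoly_eval f (H y) > 0"
      using y by (intro f_pos[rule_format]) (simp add: Pi_iff)
    then show ?thesis
      using polyfun_cong[OF F(1), of "\<lambda>j. rpoly_eval (g j) (H y)" y] eq F(2) by simp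
  qed
  obtain C \<delta> where C: "\<delta> > 0" "\<forall>y\<in>J \<rightarrow> {0..1}. F y + C * q y \<ge> \<delta>"
    using polyfun_penalty_on_cube[OF F(1) q q_nonneg F_pos] by blast
  have "polyfun J (\<lambda>y. F y + C * q y)"
    by (intro polyfun.add F(1) polyfun_mult polyfun_const q)
  from bernstein_positive_on_cube[OF assms(1) this C]
  obtain N b where b: "\<forall>k\<in>J \<rightarrow>\<^sub>E {..N}. b k \<ge> 0"
    "\<forall>y. F y + C * q y
      = (\<Sum>k\<in>J \<rightarrow>\<^sub>E {..N}. b k * ((\<Prod>j\<in>J. y j ^ k j) * (\<Prod>j\<in>J. (1 - y j) ^ (N - k j))))"
    by (elim exE conjE)
  show ?thesis
  proof (intro exI conjI allI)
    fix x
    have "q (\<lambda>j. rpoly_eval (g j) x) = 0"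
      by (simp add: q_def H_g)
    then show "rpoly_eval f x = (\<Sum>k\<in>J \<rightarrow>\<^sub>E {..N}.
        b k * ((\<Prod>j\<in>J. rpoly_eval (g j) x ^ k j) * (\<Prod>j\<in>J. (1 - rpoly_eval (g j) x) ^ (N - k j))))"
      using b(2)[rule_format, of "\<lambda>j. rpoly_eval (g j) x"] F(2)[of x] by simp
  qed (rule b(1))
qed

section \<open>The hierarchy of relaxations\<close>

lemma index_pairs_mono:
  assumes "d \<le> d'"
  shows "index_pairs m d \<subseteq> index_pairs m d'"
proof (rule subrelI)
  fix \<alpha> \<beta> assume "(\<alpha>, \<beta>) \<in> index_pairs m d"
  then show "(\<alpha>, \<beta>) \<in> index_pairs m d'"
    unfolding index_pairs_def mem_Collect_eq prod.case
    by (elim conjE, intro conjI) (assumption, erule order_trans[OF _ assms])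
qed

lemma rho_mono: "mono (rho f m g)"
proof (rule monoI)
  fix d d' :: nat
  assume "d \<le> d'"
  then have sub: "index_pairs m d \<subseteq> index_pairs m d'"
    by (rule index_pairs_mono)
  show "rho f m g d \<le> rho f m g d'"
    unfolding rho_def
  proof (rule SUP_mono, safe)
    fix l :: "(nat \<Rightarrow> nat) \<times> (nat \<Rightarrow> nat) \<Rightarrow> real"
    assume l: "\<forall>i\<in>index_pairs m d. 0 \<le> l i"
    define l' where "l' i = (if i \<in> index_pairs m d then l i else 0)" for i
    have "(\<Sum>i\<in>index_pairs m d'. l' i * T i) = (\<Sum>i\<in>index_pairs m d. l i * T i)" for T :: "_ \<Rightarrow> real"
      using sub finite_index_pairs by (intro sum.mono_neutral_cong_right) (auto simp: l'_def)
    then have "G_relax f m g d' l' = G_relax f m g d l"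
      unfolding G_relax_def by (simp add: case_prod_unfold mult.assoc)
    moreover have "\<forall>i\<in>index_pairs m d'. 0 \<le> l' i"
      using l by (simp add: l'_def)
    ultimately show "\<exists>l'\<in>{l. \<forall>i\<in>index_pairs m d'. 0 \<le> l i}. G_relax f m g d l \<le> G_relax f m g d' l'"
      by (intro bexI[of _ l']) auto
  qed
qed

lemma rho_le_value:
  assumes "\<And>j. j \<in> {1..m} \<Longrightarrow> rpoly_eval (g j) x \<in> {0..1}"
  shows "rho f m g d \<le> ereal (rpoly_eval f x)"
  unfolding rho_def
proof (rule SUP_least, clarify)
  fix l :: "(nat \<Rightarrow> nat) \<times> (nat \<Rightarrow> nat) \<Rightarrow> real"
  assume "\<forall>i\<in>index_pairs m d. 0 \<le> l i"
  then have "(\<Sum>(\<alpha>, \<beta>)\<in>index_pairs m d. l (\<alpha>, \<beta>) * (\<Prod>j=1..m. rpoly_eval (g j) x ^ \<alpha> j)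
      * (\<Prod>j=1..m. (1 - rpoly_eval (g j) x) ^ \<beta> j)) \<ge> 0"
    using assms by (auto intro!: sum_nonneg mult_nonneg_nonneg prod_nonneg zero_le_power)
  then show "G_relax f m g d l \<le> ereal (rpoly_eval f x)"
    unfolding G_relax_def by (intro INF_lower2[of x]) auto
qed

text \<open>
  With the coefficients of the representation as weights, the function under the infimum is the
  constant \<open>v\<close>. The exponents \<open>k\<^sub>j\<close> and \<open>N - k\<^sub>j\<close> add up to \<open>N\<close> for each \<open>j\<close>, whence the degree
  \<open>m * N\<close>.
\<close>

lemma rho_ge_if_representation:
  assumes b: "\<forall>k\<in>{1..m} \<rightarrow>\<^sub>E {..N}. b k \<ge> 0"
    and rep: "\<forall>x. rpoly_eval f x - v = (\<Sum>k\<in>{1..m} \<rightarrow>\<^sub>E {..N}.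
      b k * ((\<Prod>j=1..m. rpoly_eval (g j) x ^ k j) * (\<Prod>j=1..m. (1 - rpoly_eval (g j) x) ^ (N - k j))))"
  shows "ereal v \<le> rho f m g (m * N)"
proof -
  let ?K = "{1..m} \<rightarrow>\<^sub>E {..N}"
  \<comment> \<open>Members of \<open>?K\<close> are \<open>undefined\<close> outside \<open>{1..m}\<close>, multi-indices are \<open>0\<close> there.\<close>
  define \<phi> :: "(nat \<Rightarrow> nat) \<Rightarrow> (nat \<Rightarrow> nat) \<times> (nat \<Rightarrow> nat)"
    where "\<phi> k = ((\<lambda>j. if j \<in> {1..m} then k j else 0), (\<lambda>j. if j \<in> {1..m} then N - k j else 0))" for k
  have inj: "inj_on \<phi> ?K"
  proof (rule inj_onI)
    fix k k' assume k: "k \<in> ?K" "k' \<in> ?K" and eq: "\<phi> k = \<phi> k'"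
    show "k = k'"
    proof (rule PiE_ext[OF k])
      fix j assume "j \<in> {1..m}"
      then show "k j = k' j"
        using fun_cong[of _ _ j, OF arg_cong[of _ _ fst, OF eq]] by (simp add: \<phi>_def)
    qed
  qed
  have sub: "\<phi> ` ?K \<subseteq> index_pairs m (m * N)"
  proof (rule image_subsetI)
    fix k assume k: "k \<in> ?K"
    have "(\<Sum>j=1..m. k j + (N - k j)) = (\<Sum>j=1..m. N)"
      using PiE_mem[OF k] by (intro sum.cong) auto
    then show "\<phi> k \<in> index_pairs m (m * N)"
      by (simp add: \<phi>_def index_pairs_def)
  qed
  define l where "l i = (if i \<in> \<phi> ` ?K then b (the_inv_into ?K \<phi> i) else 0)" for i
  have l_\<phi>: "l (\<phi> k) = b k" if "k \<in> ?K" for k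
    using that by (simp only: l_def image_eqI if_True the_inv_into_f_f[OF inj])
  have l_nonneg: "l i \<ge> 0" for i
  proof (cases "i \<in> \<phi> ` ?K")
    case True
    then show ?thesis
      using b l_\<phi> by fastforce
  qed (simp only: l_def if_False)
  have "(\<Sum>(\<alpha>, \<beta>)\<in>index_pairs m (m * N). l (\<alpha>, \<beta>) * (\<Prod>j=1..m. rpoly_eval (g j) x ^ \<alpha> j)
      * (\<Prod>j=1..m. (1 - rpoly_eval (g j) x) ^ \<beta> j)) = rpoly_eval f x - v" for x
  proof -
    define T where "T i = (\<Prod>j=1..m. rpoly_eval (g j) x ^ fst i j)
      * (\<Prod>j=1..m. (1 - rpoly_eval (g j) x) ^ snd i j)" for i
    have "(\<Sum>i\<in>index_pairs m (m * N). l i * T i) = (\<Sum>i\<in>\<phi> ` ?K. l i * T i)"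
      using sub finite_index_pairs by (intro sum.mono_neutral_right) (auto simp: l_def)
    also have "\<dots> = (\<Sum>k\<in>?K. b k * T (\<phi> k))"
      unfolding sum.reindex[OF inj] comp_def by (rule sum.cong) (simp_all only: l_\<phi>)
    also have "\<dots> = rpoly_eval f x - v"
      unfolding rep[rule_format] T_def \<phi>_def fst_conv snd_conv
      by (intro sum.cong prod.cong arg_cong2[of _ _ _ _ "(*)"] refl) (simp_all only: if_True)
    finally show ?thesis
      by (simp add: T_def case_prod_unfold mult.assoc)
  qed
  then have "G_relax f m g (m * N) l = ereal v"
    unfolding G_relax_def by simp
  then show ?thesis
    unfolding rho_def using l_nonneg by (intro SUP_upper2[of l]) auto
qed

theorem theorem2p2:
  fixes f :: "'n::finite rpoly"
    and g :: "nat \<Rightarrow> 'n rpoly"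
    and m :: nat
    and K :: "(real ^ 'n) set"
  assumes K_def: "K = semialg_set m g"
    and K_nonempty: "K \<noteq> {}"
    and K_compact: "compact K"
    and g_bounds: "\<forall>j\<in>{1..m}. \<forall>x\<in>K. 0 \<le> rpoly_eval (g j) x \<and> rpoly_eval (g j) x \<le> 1"
    and generates: "generates_rpoly_algebra (\<Union>j\<in>{1..m}. {g j, 1 - g j})"
  shows "mono (rho f m g) \<and> rho f m g \<longlonglongrightarrow> ereal (min_on (rpoly_eval f) K)"
proof -
  define v where "v = min_on (rpoly_eval f) K"
  have "continuous_on K (rpoly_eval f)"
    unfolding rpoly_eval_def by (intro continuous_intros)
  note min = min_on_compact[OF K_compact K_nonempty this, folded v_def]
  obtain a where a: "a \<in> K" "v = rpoly_eval f a"
    using min(1) by blast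
  have upper: "rho f m g d \<le> ereal v" for d
    unfolding a(2) using g_bounds a(1) by (intro rho_le_value) auto
  have lower: "\<exists>d. ereal (v - e) \<le> rho f m g d" if e: "e > 0" for e
  proof -
    let ?f = "f + rpoly_const (e - v)"
    have f_eval: "rpoly_eval ?f x = rpoly_eval f x - (v - e)" for x
      by (simp add: rpoly_eval_add rpoly_eval_const)
    have f_pos: "\<forall>x. (\<lambda>j. rpoly_eval (g j) x) \<in> {1..m} \<rightarrow> {0..1} \<longrightarrow> rpoly_eval ?f x > 0"
    proof (intro allI impI)
      fix x assume x: "(\<lambda>j. rpoly_eval (g j) x) \<in> {1..m} \<rightarrow> {0..1}"
      have "x \<in> K"
        using x by (simp add: K_def semialg_set_def Pi_iff)
      from min(2)[OF this] e show "rpoly_eval ?f x > 0"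
        by (simp add: f_eval)
    qed
    from positive_polynomial_representation[OF finite_atLeastAtMost generates f_pos]
    obtain N b where "\<forall>k\<in>{1..m} \<rightarrow>\<^sub>E {..N}. b k \<ge> 0"
      and "\<forall>x. rpoly_eval ?f x = (\<Sum>k\<in>{1..m} \<rightarrow>\<^sub>E {..N}.
        b k * ((\<Prod>j=1..m. rpoly_eval (g j) x ^ k j) * (\<Prod>j=1..m. (1 - rpoly_eval (g j) x) ^ (N - k j))))"
      by (elim exE conjE)
    then have "ereal (v - e) \<le> rho f m g (m * N)"
      unfolding f_eval by (rule rho_ge_if_representation)
    then show ?thesis ..
  qed
  have "(SUP d. rho f m g d) = ereal v"
  proof (rule antisym)
    show "(SUP d. rho f m g d) \<le> ereal v"
      by (rule SUP_least) (rule upper)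
    show "ereal v \<le> (SUP d. rho f m g d)"
    proof (rule ereal_le_epsilon2)
      fix e :: real assume "e > 0"
      then obtain d where "ereal (v - e) \<le> rho f m g d"
        using lower by blast
      also have "\<dots> \<le> (SUP d. rho f m g d)"
        by (rule SUP_upper) simp
      finally have "ereal (v - e) + ereal e \<le> (SUP d. rho f m g d) + ereal e"
        by (rule add_right_mono)
      then show "ereal v \<le> (SUP d. rho f m g d) + ereal e"
        by simp
    qed
  qed
  moreover have "rho f m g \<longlonglongrightarrow> (SUP d. rho f m g d)"
    using rho_mono by (rule LIMSEQ_SUP)
  ultimately show ?thesis
    unfolding v_def[symmetric] using rho_mono by simp
qed

end
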